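(* Let $\mathbb{L}^3$ be $\mathbb{R}^3$ with coordinates $(x,y,z)$ and the metric $g=-2\,dx\,dy+dz^2$. Let $\lambda>0$ and $a_0,z_0\in\mathbb{R}$, and let $\psi(y,z)=(u(y,z),y,z)$ be an inextensible solution with $$u(y,z)=-2\lambda^2y+4\lambda^2\log\left|\sinh\left(\tfrac{z-z_0}{2\lambda}\right)\right|+a_0 .$$ Then $\psi$ is time-like, it is not entire, and it is not complete in each of the space-like, time-like and light-like senses.
   Context: $\log$ denotes the natural logarithm. A solution is inextensible if its domain $\Omega\subset\mathbb{R}^2$ is a maximal connected open set on which the formula for $u$ defines a smooth function. It is entire if $\Omega=\mathbb{R}^2$. It is time-like if the induced metric $\psi^*g$ on $\Omega$ is Lorentzian. It is not complete in the space-like (respectively time-like, light-like) sense if $(\Omega,\psi^*g)$ admits an inextensible space-like (respectively time-like, light-like) geodesic whose affine parameter is not defined on all of $\mathbb{R}$. *)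

theory Defs
  imports "HOL-Analysis.Analysis"
begin

text \<open>Meaningful for open \<open>S\<close>: \<open>C_on k S f\<close> says that \<open>f\<close> is of class \<open>C\<^sup>k\<close> on \<open>S\<close>
  (finite-dimensional domain).\<close>

primrec C_on :: "nat \<Rightarrow> 'a set \<Rightarrow> ('a::real_normed_vector \<Rightarrow> 'b::real_normed_vector) \<Rightarrow> bool" where
  "C_on 0 S f \<longleftrightarrow> continuous_on S f"
| "C_on (Suc k) S f \<longleftrightarrow> (\<forall>x\<in>S. f differentiable (at x)) \<and>
     (\<forall>v. C_on k S (\<lambda>x. frechet_derivative f (at x) v))"

definition smooth_on :: "'a set \<Rightarrow> ('a::real_normed_vector \<Rightarrow> 'b::real_normed_vector) \<Rightarrow> bool" where
  "smooth_on S f \<longleftrightarrow> (\<forall>k. C_on k S f)"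

text \<open>\<open>D\<close> is the set of points at which the formula for \<open>u\<close> makes sense. It is recorded separately
  because HOL functions are total (for instance \<open>ln 0 = 0\<close>).\<close>

definition formula_domain :: "'a set \<Rightarrow> ('a::real_normed_vector \<Rightarrow> real) \<Rightarrow> 'a set \<Rightarrow> bool" where
  "formula_domain D u \<Omega> \<longleftrightarrow> open \<Omega> \<and> connected \<Omega> \<and> \<Omega> \<subseteq> D \<and> smooth_on \<Omega> u"

definition inextensible_domain :: "'a set \<Rightarrow> ('a::real_normed_vector \<Rightarrow> real) \<Rightarrow> 'a set \<Rightarrow> bool" where
  "inextensible_domain D u \<Omega> \<longleftrightarrow> formula_domain D u \<Omega> \<and>
     (\<forall>\<Omega>'. formula_domain D u \<Omega>' \<and> \<Omega> \<subseteq> \<Omega>' \<longrightarrow> \<Omega>' = \<Omega>)"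

text \<open>A field of bilinear forms on \<open>\<real>\<^sup>n\<close>: base point, then two tangent vectors.\<close>

type_synonym 'n tensor2 = "real^'n \<Rightarrow> real^'n \<Rightarrow> real^'n \<Rightarrow> real"

text \<open>The metric \<open>-2 dx dy + dz\<^sup>2\<close> in the coordinates \<open>x = p $ 1\<close>, \<open>y = p $ 2\<close>, \<open>z = p $ 3\<close>, with
  \<open>dx dy\<close> the symmetric product.\<close>

definition L3_metric :: "3 tensor2" where
  "L3_metric p v w = - (v $ 1 * w $ 2 + v $ 2 * w $ 1) + v $ 3 * w $ 3"

text \<open>Points of the parameter plane are \<open>(y, z) = (p $ 1, p $ 2)\<close>.\<close>

definition graph_map :: "(real^2 \<Rightarrow> real) \<Rightarrow> real^2 \<Rightarrow> real^3" where
  "graph_map u p = vector [u p, p $ 1, p $ 2]"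

definition pullback :: "(real^'m \<Rightarrow> real^'n) \<Rightarrow> 'n tensor2 \<Rightarrow> 'm tensor2" where
  "pullback \<psi> g p v w =
     g (\<psi> p) (frechet_derivative \<psi> (at p) v) (frechet_derivative \<psi> (at p) w)"

definition form_index :: "(real^'n \<Rightarrow> real^'n \<Rightarrow> real) \<Rightarrow> nat" where
  "form_index B = Max (dim ` {W. subspace W \<and> (\<forall>v\<in>W. v \<noteq> 0 \<longrightarrow> B v v < 0)})"

definition lorentzian_form :: "(real^'n \<Rightarrow> real^'n \<Rightarrow> real) \<Rightarrow> bool" where
  "lorentzian_form B \<longleftrightarrow> bilinear B \<and> (\<forall>v w. B v w = B w v) \<and>
     (\<forall>v. (\<forall>w. B v w = 0) \<longrightarrow> v = 0) \<and> form_index B = 1"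

definition lorentzian_on :: "(real^'n) set \<Rightarrow> 'n tensor2 \<Rightarrow> bool" where
  "lorentzian_on \<Omega> h \<longleftrightarrow> (\<forall>v w. smooth_on \<Omega> (\<lambda>p. h p v w)) \<and> (\<forall>p\<in>\<Omega>. lorentzian_form (h p))"

definition gram :: "'n tensor2 \<Rightarrow> real^'n \<Rightarrow> real^'n^'n" where
  "gram h p = (\<chi> i j. h p (axis i 1) (axis j 1))"

definition pd_gram :: "'n::finite tensor2 \<Rightarrow> real^'n \<Rightarrow> 'n \<Rightarrow> 'n \<Rightarrow> 'n \<Rightarrow> real" where
  "pd_gram h p i j l = frechet_derivative (\<lambda>q. gram h q $ j $ l) (at p) (axis i 1)"

text \<open>\<open>\<Gamma>\<^sup>k\<^sub>i\<^sub>j = 1/2 \<Sum>\<^sub>l h\<^sup>k\<^sup>l (\<partial>\<^sub>i h\<^sub>j\<^sub>l + \<partial>\<^sub>j h\<^sub>i\<^sub>l - \<partial>\<^sub>l h\<^sub>i\<^sub>j)\<close>\<close>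

definition christoffel :: "'n::finite tensor2 \<Rightarrow> real^'n \<Rightarrow> 'n \<Rightarrow> 'n \<Rightarrow> 'n \<Rightarrow> real" where
  "christoffel h p k i j = (1/2) * (\<Sum>l\<in>UNIV. matrix_inv (gram h p) $ k $ l *
     (pd_gram h p i j l + pd_gram h p j i l - pd_gram h p l i j))"

abbreviation velocity :: "(real \<Rightarrow> real^'n) \<Rightarrow> real \<Rightarrow> real^'n" where
  "velocity \<gamma> t \<equiv> vector_derivative \<gamma> (at t)"

definition geodesic :: "'n::finite tensor2 \<Rightarrow> (real^'n) set \<Rightarrow> real set \<Rightarrow> (real \<Rightarrow> real^'n) \<Rightarrow> bool" where
  "geodesic h \<Omega> I \<gamma> \<longleftrightarrow> open I \<and> connected I \<and> I \<noteq> {} \<and> \<gamma> ` I \<subseteq> \<Omega> \<and> smooth_on I \<gamma> \<and>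
     (\<forall>t\<in>I. \<forall>k. velocity (velocity \<gamma>) t $ k +
        (\<Sum>i\<in>UNIV. \<Sum>j\<in>UNIV. christoffel h (\<gamma> t) k i j * velocity \<gamma> t $ i * velocity \<gamma> t $ j) = 0)"

definition inextensible_geodesic ::
    "'n::finite tensor2 \<Rightarrow> (real^'n) set \<Rightarrow> real set \<Rightarrow> (real \<Rightarrow> real^'n) \<Rightarrow> bool" where
  "inextensible_geodesic h \<Omega> I \<gamma> \<longleftrightarrow> geodesic h \<Omega> I \<gamma> \<and>
     (\<forall>J \<sigma>. geodesic h \<Omega> J \<sigma> \<and> I \<subseteq> J \<and> (\<forall>t\<in>I. \<sigma> t = \<gamma> t) \<longrightarrow> J = I)"

text \<open>The zero vector has none of the three causal characters here, so that constant curves are not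
  counted as space-like or light-like geodesics; being complete, they are irrelevant to
  incompleteness under any convention.\<close>

definition spacelike :: "(real^'n \<Rightarrow> real^'n \<Rightarrow> real) \<Rightarrow> real^'n \<Rightarrow> bool" where
  "spacelike B v \<longleftrightarrow> B v v > 0"

definition timelike :: "(real^'n \<Rightarrow> real^'n \<Rightarrow> real) \<Rightarrow> real^'n \<Rightarrow> bool" where
  "timelike B v \<longleftrightarrow> B v v < 0"

definition lightlike :: "(real^'n \<Rightarrow> real^'n \<Rightarrow> real) \<Rightarrow> real^'n \<Rightarrow> bool" where
  "lightlike B v \<longleftrightarrow> v \<noteq> 0 \<and> B v v = 0"

definition incomplete_on ::
    "((real^'n \<Rightarrow> real^'n \<Rightarrow> real) \<Rightarrow> real^'n \<Rightarrow> bool) \<Rightarrow> (real^'n) set \<Rightarrow> 'n::finite tensor2 \<Rightarrow> bool" where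
  "incomplete_on causal \<Omega> h \<longleftrightarrow> (\<exists>I \<gamma>. inextensible_geodesic h \<Omega> I \<gamma> \<and>
     (\<forall>t\<in>I. causal (h (\<gamma> t)) (velocity \<gamma> t)) \<and> I \<noteq> UNIV)"

end

theory Submission
  imports Defs
begin

text \<open>With \<open>s = (z - z0) / (2 lam)\<close> the induced metric is
  \<open>4 lam\<^sup>2 (dy\<^sup>2 - 2 coth s dy ds + ds\<^sup>2)\<close>. Its determinant is negative because \<open>coth\<^sup>2 s > 1\<close>, hence
  it is Lorentzian (\<open>lorentzian_tilted_form\<close>). The formula for \<open>u\<close> breaks down exactly on the line
  \<open>z = z0\<close> and is smooth elsewhere, so a maximal domain is one of the two open half planes bounded by
  this line (\<open>inextensible_domain_half_plane\<close>). In particular it is not the whole plane.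

  Both \<open>\<partial>\<^sub>y\<close>, a Killing field, and the speed give first integrals of the geodesic equations:
  \<open>y' - coth s s' = c\<close> and \<open>y'\<^sup>2 - 2 coth s y' s' + s'\<^sup>2 = e\<close>. Eliminating \<open>y'\<close> leaves
  \<open>s'\<^sup>2 = (c\<^sup>2 - e) sinh\<^sup>2 s\<close>. The solutions of \<open>s' = k sinh s\<close> with \<open>k \<noteq> 0\<close> reach infinity in finite
  time, whatever the causal type. Normalising \<open>c\<^sup>2 - e = 1\<close>, one obtains for each \<open>c\<close> the explicit
  geodesic
  \<open>y = c t - ln (- sinh t)\<close>, \<open>sinh s = - \<epsilon> / sinh t\<close> on \<open>t < 0\<close>, where the sign \<open>\<epsilon> = \<plusminus>1\<close> selects the half
  plane. Its velocity has square \<open>4 lam\<^sup>2 (c\<^sup>2 - 1)\<close> (\<open>energy_escaping_curve\<close>), so \<open>c = 2, 0, 1\<close> give a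
  space-like, a time-like and a light-like geodesic. None of them extends, even continuously, to
  \<open>t = 0\<close>, since \<open>z\<close> is unbounded there (\<open>inextensible_escaping_curve\<close>).\<close>

section \<open>Calculus of \<open>C\<^sup>k\<close> functions\<close>

lemma C_on_cong:
  assumes "open S" "\<And>x. x \<in> S \<Longrightarrow> f x = g x" "C_on k S f"
  shows "C_on k S g"
  using assms(2,3)
proof (induction k arbitrary: f g)
  case 0
  then show ?case by (metis C_on.simps(1) continuous_on_cong)
next
  case (Suc k)
  have D: "(g has_derivative frechet_derivative f (at x)) (at x)" if "x \<in> S" for x
  proof (rule has_derivative_transform_within_open[OF _ \<open>open S\<close> that])
    show "(f has_derivative frechet_derivative f (at x)) (at x)"
      using Suc.prems(2) that by (simp add: frechet_derivative_works)
  qed (use Suc.prems(1) in auto)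
  have "C_on k S (\<lambda>x. frechet_derivative g (at x) v)" for v
  proof (rule Suc.IH)
    show "C_on k S (\<lambda>x. frechet_derivative f (at x) v)"
      using Suc.prems(2) by simp
    show "frechet_derivative f (at x) v = frechet_derivative g (at x) v" if "x \<in> S" for x
      using frechet_derivative_at[OF D[OF that]] by simp
  qed
  then show ?case
    using D by (auto simp: differentiable_def)
qed

text \<open>The recursion defining \<open>C_on\<close> speaks of \<open>frechet_derivative\<close>, a choice operator. This rule lets any
  explicit family of derivatives, valid on \<open>S\<close> only, take its place, and is the way in which
  smoothness is established below.\<close>
lemma C_on_SucI:
  assumes "open S"
    and D: "\<And>x. x \<in> S \<Longrightarrow> (f has_derivative f' x) (at x)"
    and C: "\<And>v. C_on k S (\<lambda>x. f' x v)"
  shows "C_on (Suc k) S f"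
proof -
  have "C_on k S (\<lambda>x. frechet_derivative f (at x) v)" for v
    by (rule C_on_cong[OF \<open>open S\<close> _ C[of v]]) (simp add: frechet_derivative_at[OF D, symmetric])
  then show ?thesis
    using D by (auto simp: differentiable_def)
qed

lemma C_on_Suc_imp:
  assumes "C_on (Suc k) S f"
  shows "C_on k S f"
  using assms
proof (induction k arbitrary: f)
  case 0
  then show ?case
    by (auto intro!: differentiable_imp_continuous_on
        simp: differentiable_on_def differentiable_at_withinI)
next
  case (Suc k)
  then show ?case by (metis C_on.simps(2))
qed

lemma smooth_onI: "(\<And>k. C_on (Suc k) S f) \<Longrightarrow> smooth_on S f"
  unfolding smooth_on_def using C_on_Suc_imp by blast

lemma C_on_const: "C_on k S (\<lambda>x. c)"
  by (induction k arbitrary: c) auto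

lemma C_on_add:
  assumes "open S" "C_on k S f" "C_on k S g"
  shows "C_on k S (\<lambda>x. f x + g x)"
  using assms(2,3)
proof (induction k arbitrary: f g)
  case 0
  then show ?case by (simp add: continuous_on_add)
next
  case (Suc k)
  show ?case
  proof (rule C_on_SucI[OF \<open>open S\<close>])
    show "((\<lambda>x. f x + g x) has_derivative
        (\<lambda>v. frechet_derivative f (at x) v + frechet_derivative g (at x) v)) (at x)" if "x \<in> S" for x
      using Suc.prems that by (auto intro!: has_derivative_add simp: frechet_derivative_works)
  qed (use Suc in auto)
qed

lemma C_on_mult:
  fixes f g :: "'a::real_normed_vector \<Rightarrow> 'b::real_normed_algebra"
  assumes "open S" "C_on k S f" "C_on k S g"
  shows "C_on k S (\<lambda>x. f x * g x)"
  using assms(2,3)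
proof (induction k arbitrary: f g)
  case 0
  then show ?case by (simp add: continuous_on_mult)
next
  case (Suc k)
  show ?case
  proof (rule C_on_SucI[OF \<open>open S\<close>])
    show "((\<lambda>x. f x * g x) has_derivative
        (\<lambda>v. f x * frechet_derivative g (at x) v + frechet_derivative f (at x) v * g x)) (at x)"
      if "x \<in> S" for x
      using Suc.prems that by (auto intro!: has_derivative_mult simp: frechet_derivative_works)
    show "C_on k S (\<lambda>x. f x * frechet_derivative g (at x) v + frechet_derivative f (at x) v * g x)" for v
      using Suc.prems C_on_Suc_imp by (intro C_on_add[OF \<open>open S\<close>] Suc.IH) auto
  qed
qed

text \<open>Maps into \<open>\<real>\<^sup>n\<close> are handled one coordinate at a time. This rule gives
  differentiability and, by induction on \<open>k\<close>, the corresponding principle for \<open>C_on\<close>.\<close>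
lemma has_derivative_vecI:
  fixes f :: "'a::real_normed_vector \<Rightarrow> real^'n"
  assumes "\<And>i. ((\<lambda>x. f x $ i) has_derivative (\<lambda>v. f' v $ i)) (at a within S)"
  shows "(f has_derivative f') (at a within S)"
  using assms
  by (subst has_derivative_componentwise_within) (auto simp: Basis_vec_def inner_axis)

lemma has_derivative_vec_nth: "((\<lambda>x. x $ i) has_derivative (\<lambda>v. v $ i)) F"
  for i :: "'n::finite"
  by (rule bounded_linear_imp_has_derivative[OF bounded_linear_vec_nth])

lemma C_on_vecI:
  fixes f :: "'a::real_normed_vector \<Rightarrow> real^'n"
  assumes "open S" "\<And>i. C_on k S (\<lambda>x. f x $ i)"
  shows "C_on k S f"
  using assms(2)
proof (induction k arbitrary: f)
  case 0
  then show ?case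
    by (simp add: continuous_on_componentwise[of S f] Basis_vec_def inner_axis)
next
  case (Suc k)
  show ?case
  proof (rule C_on_SucI[OF \<open>open S\<close>])
    let ?D = "\<lambda>x v. \<chi> i. frechet_derivative (\<lambda>x. f x $ i) (at x) v"
    show "(f has_derivative ?D x) (at x)" if "x \<in> S" for x
      using Suc.prems that by (intro has_derivative_vecI) (simp add: frechet_derivative_works)
    show "C_on k S (\<lambda>x. ?D x v)" for v
      using Suc by simp
  qed
qed

section \<open>Lorentzian forms on the plane\<close>

text \<open>In dimension two an indefinite form has no room for anything but signature \<open>(1, 1)\<close>: a
  negative definite subspace of dimension two would contain the positive vector \<open>b\<close>, and a radical
  vector together with \<open>a\<close> would span the plane, making the form negative semidefinite.\<close>
lemma dim_2_lorentzian:
  fixes B :: "real^2 \<Rightarrow> real^2 \<Rightarrow> real"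
  assumes bil: "bilinear B" and sym: "\<And>v w. B v w = B w v"
    and neg: "B a a < 0" and pos: "B b b > 0"
  shows "lorentzian_form B"
proof -
  let ?N = "{W. subspace W \<and> (\<forall>v\<in>W. v \<noteq> 0 \<longrightarrow> B v v < 0)}"
  have B: "B (r *\<^sub>R v) w = r * B v w" "B v (r *\<^sub>R w) = r * B v w"
     "B (v + v') w = B v w + B v' w" "B v (w + w') = B v w + B v w'" for r v w v' w'
    using bil by (simp_all add: bilinear_lmul bilinear_rmul bilinear_ladd bilinear_radd)
  have "a \<noteq> 0" "b \<noteq> 0"
    using neg pos bilinear_lzero[OF bil] by fastforce+
  have le1: "dim W \<le> 1" if "W \<in> ?N" for W
  proof (rule ccontr)
    assume "\<not> dim W \<le> 1"
    moreover have "dim W \<le> 2"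
      using dim_subset_UNIV[of W] by simp
    ultimately have "dim W = DIM(real^2)" by simp
    then have "span W = UNIV" by (simp only: dim_eq_full)
    then have "W = UNIV"
      using that by (metis (lifting) mem_Collect_eq span_eq_iff)
    with that \<open>b \<noteq> 0\<close> pos show False by fastforce
  qed
  have "B (r *\<^sub>R a) (r *\<^sub>R a) < 0" if "r \<noteq> 0" for r
    using mult_pos_neg[OF _ neg, of "r * r"] that
    by (auto simp: B mult.assoc zero_less_mult_iff linorder_neq_iff)
  then have "span {a} \<in> ?N"
    using subspace_span[of "{a}"] by (auto simp: span_singleton)
  moreover have "dim (span {a}) = 1"
    using \<open>a \<noteq> 0\<close> by simp
  ultimately have 1: "1 \<in> dim ` ?N" by force
  have "finite (dim ` ?N)"
    by (rule finite_subset[of _ "{..1}"]) (use le1 in auto)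
  then have "form_index B = 1"
    unfolding form_index_def using le1 1 by (intro Max_eqI) auto
  moreover have "v = 0" if rad: "\<And>w. B v w = 0" for v
  proof (rule ccontr)
    assume "v \<noteq> 0"
    have "v \<noteq> a" using neg rad by force
    have "a \<notin> span {v}"
      using neg rad by (auto simp: span_singleton B)
    then have "independent {a, v}"
      using \<open>v \<noteq> 0\<close> by (intro independent_insertI) (auto simp: independent_empty)
    then have "dim {a, v} = DIM(real^2)"
      using \<open>v \<noteq> a\<close> by (simp add: dim_eq_card_independent)
    then have "b \<in> span {a, v}" by (simp only: dim_eq_full) simp
    then obtain r s where "b = r *\<^sub>R a + s *\<^sub>R v"
      by (auto simp: span_insert span_singleton algebra_simps) 
    then have "B b b = r\<^sup>2 * B a a"
      by (simp add: B rad sym[of a v] power2_eq_square)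
    with neg pos show False
      by (metis linorder_not_less mult_nonneg_nonpos order_less_imp_le zero_le_power2)
  qed
  ultimately show ?thesis
    using bil sym by (auto simp: lorentzian_form_def)
qed

section \<open>Regularity of the hyperbolic cotangent\<close>

lemma C_on_SucI_real:
  fixes f :: "real \<Rightarrow> real"
  assumes "open S"
    and D: "\<And>t. t \<in> S \<Longrightarrow> (f has_real_derivative f' t) (at t)"
    and C: "C_on k S f'"
  shows "C_on (Suc k) S f"
  using D C
  by (intro C_on_SucI[OF \<open>open S\<close>, where f' = "\<lambda>t h. f' t * h"] C_on_mult[OF \<open>open S\<close>] C_on_const)
     (auto simp: has_field_derivative_def)

text \<open>Bootstrapping: the right-hand side of \<open>df = (1 - f\<^sup>2) L\<close> is a polynomial in \<open>f\<close>, hence as regular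
  as \<open>f\<close>, so each derivative comes for free. Both \<open>coth\<close> on the line and its composition with the
  coordinate \<open>z\<close> on the plane are of this kind.\<close>
lemma C_on_riccati:
  fixes f :: "'a::real_normed_vector \<Rightarrow> real"
  assumes "open S"
    and D: "\<And>x. x \<in> S \<Longrightarrow> (f has_derivative (\<lambda>v. (1 - (f x)\<^sup>2) * L v)) (at x)"
  shows "C_on k S f"
proof (induction k)
  case 0
  have "continuous_on S f"
    using D by (meson continuous_at_imp_continuous_on has_derivative_continuous)
  then show ?case by simp
next
  case (Suc k)
  have "C_on k S (\<lambda>x. (1 + (- 1) * (f x * f x)) * L v)" for v
    by (intro C_on_mult C_on_add C_on_const Suc \<open>open S\<close>)
  then show ?case
    by (intro C_on_SucI[OF \<open>open S\<close> D]) (simp_all add: power2_eq_square)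
qed

definition coth :: "real \<Rightarrow> real" where
  "coth x = cosh x / sinh x"

lemma one_minus_coth_squared:
  assumes "x \<noteq> 0"
  shows "1 - (coth x)\<^sup>2 = - 1 / (sinh x)\<^sup>2"
proof -
  have "(coth x)\<^sup>2 = ((sinh x)\<^sup>2 + 1) / (sinh x)\<^sup>2"
    unfolding coth_def power_divide cosh_square_eq by simp
  then show ?thesis
    using assms by (simp add: add_divide_distrib)
qed

lemma DERIV_coth:
  assumes "x \<noteq> 0"
  shows "(coth has_real_derivative 1 - (coth x)\<^sup>2) (at x)"
proof -
  have "((\<lambda>x. cosh x / sinh x) has_real_derivative
      (sinh x * sinh x - cosh x * cosh x) / (sinh x * sinh x)) (at x)"
    using DERIV_divide[OF has_field_derivative_cosh[OF DERIV_ident]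
        has_field_derivative_sinh[OF DERIV_ident], where x = x and s = UNIV] assms by simp
  moreover have "(sinh x * sinh x - cosh x * cosh x) / (sinh x * sinh x) = 1 - (coth x)\<^sup>2"
    using assms by (simp add: coth_def power2_eq_square diff_divide_distrib)
  ultimately show ?thesis
    by (simp add: coth_def[abs_def])
qed

lemma DERIV_inverse_sinh:
  assumes "x \<noteq> 0"
  shows "((\<lambda>x. 1 / sinh x) has_real_derivative - 1 * (coth x * (1 / sinh x))) (at x)"
  using DERIV_divide[OF DERIV_const[where k = 1] has_field_derivative_sinh[OF DERIV_ident],
      where x = x and s = UNIV] assms
  by (simp add: coth_def)

lemma C_on_coth:
  assumes "open S" "0 \<notin> S"
  shows "C_on k S coth"
proof (rule C_on_riccati[OF \<open>open S\<close>, where L = "\<lambda>h. h"])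
  show "(coth has_derivative (\<lambda>h. (1 - (coth x)\<^sup>2) * h)) (at x)" if "x \<in> S" for x
    using DERIV_coth[of x] that assms(2) by (auto simp: has_field_derivative_def)
qed

lemma C_on_inverse_sinh:
  assumes "open S" "0 \<notin> S"
  shows "C_on k S (\<lambda>x::real. 1 / sinh x)"
proof (induction k)
  case 0
  show ?case using assms by (auto intro!: continuous_intros)
next
  case (Suc k)
  have "C_on k S (\<lambda>x. - 1 * (coth x * (1 / sinh x)))"
    by (intro C_on_mult C_on_const C_on_coth assms Suc)
  then show ?case
    by (rule C_on_SucI_real[OF \<open>open S\<close> DERIV_inverse_sinh, rotated]) (use assms in auto)
qed

section \<open>The solution and its induced metric\<close>

definition coth_z :: "real \<Rightarrow> real \<Rightarrow> real^2 \<Rightarrow> real" where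
  "coth_z lam z0 p = coth ((p $ 2 - z0) / (2 * lam))"

lemma has_derivative_coth_z:
  assumes "lam > 0" "p $ 2 \<noteq> z0"
  shows "(coth_z lam z0 has_derivative (\<lambda>v. (1 - (coth_z lam z0 p)\<^sup>2) * (v $ 2 / (2 * lam)))) (at p)"
proof -
  have "((\<lambda>p. (p $ 2 - z0) / (2 * lam)) has_derivative (\<lambda>v. v $ 2 / (2 * lam))) (at p)"
    using assms by (auto intro!: derivative_eq_intros has_derivative_vec_nth)
  from DERIV_compose_FDERIV[OF DERIV_coth this] show ?thesis
    using assms by (simp add: coth_z_def[abs_def] mult.commute)
qed

lemma C_on_coth_z:
  assumes "lam > 0" "open S" "\<And>p. p \<in> S \<Longrightarrow> p $ 2 \<noteq> z0"
  shows "C_on k S (coth_z lam z0)"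
  by (rule C_on_riccati[OF \<open>open S\<close> has_derivative_coth_z]) (use assms in auto)

text \<open>Replacing the absolute value by a square makes the two half planes accessible to a single
  application of the chain rule.\<close>
lemma ln_abs_eq: "ln \<bar>x\<bar> = ln (x\<^sup>2) / 2" for x :: real
  by (cases "x = 0") (use ln_realpow[of "\<bar>x\<bar>" 2] in auto)

definition solution :: "real \<Rightarrow> real \<Rightarrow> real \<Rightarrow> real^2 \<Rightarrow> real" where
  "solution lam a0 z0 p = - 2 * lam^2 * p $ 1
               + 4 * lam^2 * ln \<bar>sinh ((p $ 2 - z0) / (2 * lam))\<bar> + a0"

lemma has_derivative_solution:
  assumes "lam > 0" "p $ 2 \<noteq> z0"
  shows "(solution lam a0 z0 has_derivative
    (\<lambda>v. - 2 * lam\<^sup>2 * v $ 1 + 2 * lam * coth_z lam z0 p * v $ 2)) (at p)"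
proof -
  have nz: "sinh ((p $ 2 - z0) / (2 * lam)) \<noteq> 0"
    using assms by simp
  have 1: "((\<lambda>p. (p $ 2 - z0) / (2 * lam)) has_derivative (\<lambda>v. v $ 2 / (2 * lam))) (at p)"
    using assms by (auto intro!: derivative_eq_intros has_derivative_vec_nth)
  have 2: "((\<lambda>s. ln \<bar>sinh s\<bar>) has_real_derivative coth s) (at s)" if "s \<noteq> 0" for s :: real
  proof -
    have "((\<lambda>s. (sinh s)\<^sup>2) has_real_derivative 2 * sinh s * cosh s) (at s)"
      using DERIV_power[OF has_field_derivative_sinh[OF DERIV_ident], where x = s and s = UNIV and n = 2]
      by (simp add: mult_ac)
    moreover have "(sinh s)\<^sup>2 > 0"
      using that by simp
    ultimately have "((\<lambda>s. ln ((sinh s)\<^sup>2) / 2) has_real_derivative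
        inverse ((sinh s)\<^sup>2) * (2 * sinh s * cosh s) / 2) (at s)"
      by (intro DERIV_cdivide DERIV_chain2[OF DERIV_ln])
    then show ?thesis
      using that by (simp add: ln_abs_eq coth_def power2_eq_square field_simps)
  qed
  have 3: "((\<lambda>p. ln \<bar>sinh ((p $ 2 - z0) / (2 * lam))\<bar>) has_derivative
      (\<lambda>v. v $ 2 / (2 * lam) * coth_z lam z0 p)) (at p)"
    using DERIV_compose_FDERIV[OF 2 1] assms by (simp add: coth_z_def)
  show ?thesis
    unfolding solution_def[abs_def]
    by (rule 3 has_derivative_vec_nth derivative_eq_intros refl)+
       (use assms in \<open>simp add: fun_eq_iff field_simps power2_eq_square\<close>)
qed

text \<open>The common shape of the induced metric at all points, with \<open>C\<close> standing for the value of
  \<open>coth s\<close>: the base point enters through this one number.\<close>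
definition tilted_form :: "real \<Rightarrow> real \<Rightarrow> real^2 \<Rightarrow> real^2 \<Rightarrow> real" where
  "tilted_form lam C v w =
     4 * lam\<^sup>2 * (v $ 1 * w $ 1) - 2 * lam * C * (v $ 1 * w $ 2 + v $ 2 * w $ 1) + v $ 2 * w $ 2"

lemma pullback_graph_map:
  assumes "(u has_derivative u') (at p)"
  shows "pullback (graph_map u) L3_metric p v w =
    - (u' v * w $ 1 + v $ 1 * u' w) + v $ 2 * w $ 2"
proof -
  have "((\<lambda>p. graph_map u p $ i) has_derivative (\<lambda>v. vector [u' v, v $ 1, v $ 2] $ i)) (at p)" for i
    using exhaust_3[of i] assms
    by (auto simp: graph_map_def intro!: has_derivative_vec_nth)
  then have "(graph_map u has_derivative (\<lambda>v. vector [u' v, v $ 1, v $ 2])) (at p)"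
    by (rule has_derivative_vecI)
  from frechet_derivative_at[OF this, symmetric] show ?thesis
    by (simp add: pullback_def L3_metric_def)
qed

lemma induced_metric:
  assumes "lam > 0" "p $ 2 \<noteq> z0"
  shows "pullback (graph_map (solution lam a0 z0)) L3_metric p = tilted_form lam (coth_z lam z0 p)"
  by (simp add: fun_eq_iff pullback_graph_map[OF has_derivative_solution[OF assms]]
      tilted_form_def algebra_simps)

lemma lorentzian_tilted_form:
  assumes "lam > 0" "C\<^sup>2 > 1"
  shows "lorentzian_form (tilted_form lam C)"
proof (rule dim_2_lorentzian)
  show "bilinear (tilted_form lam C)"
    by (auto simp: bilinear_def tilted_form_def algebra_simps intro!: linearI)
  show "tilted_form lam C v w = tilted_form lam C w v" for v w
    by (simp add: tilted_form_def algebra_simps)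
  show "tilted_form lam C (vector [0, 1]) (vector [0, 1]) > 0"
    by (simp add: tilted_form_def)
  have "tilted_form lam C (vector [1, 2 * lam * C]) (vector [1, 2 * lam * C]) = 4 * lam\<^sup>2 * (1 - C\<^sup>2)"
    by (simp add: tilted_form_def algebra_simps power2_eq_square)
  also have "\<dots> < 0"
    using assms by (simp add: mult_less_0_iff)
  finally show "tilted_form lam C (vector [1, 2 * lam * C]) (vector [1, 2 * lam * C]) < 0" .
qed

lemma coth_z_squared_gt_1:
  assumes "lam > 0" "p $ 2 \<noteq> z0"
  shows "(coth_z lam z0 p)\<^sup>2 > 1"
proof -
  have "1 - (coth_z lam z0 p)\<^sup>2 < 0"
    unfolding coth_z_def using assms by (subst one_minus_coth_squared) (auto simp: divide_simps)
  then show ?thesis by simp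
qed

lemma lorentzian_on_solution:
  assumes "lam > 0" "open S" and S: "\<And>p. p \<in> S \<Longrightarrow> p $ 2 \<noteq> z0"
  shows "lorentzian_on S (pullback (graph_map (solution lam a0 z0)) L3_metric)"
proof -
  let ?h = "pullback (graph_map (solution lam a0 z0)) L3_metric"
  have "C_on k S (\<lambda>p. ?h p v w)" for k v w
  proof (rule C_on_cong[OF \<open>open S\<close>])
    show "C_on k S (\<lambda>p. (4 * lam\<^sup>2 * (v $ 1 * w $ 1) + v $ 2 * w $ 2)
        + (- 2 * lam * (v $ 1 * w $ 2 + v $ 2 * w $ 1)) * coth_z lam z0 p)"
      using assms by (intro C_on_add C_on_mult C_on_const C_on_coth_z)
  qed (simp add: induced_metric[OF \<open>lam > 0\<close> S] tilted_form_def algebra_simps)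
  then show ?thesis
    using assms by (simp add: lorentzian_on_def smooth_on_def induced_metric
        lorentzian_tilted_form coth_z_squared_gt_1)
qed

lemma matrix_inv_eqI:
  fixes A :: "real^'n^'m"
  assumes "A ** B = mat 1" "B ** A = mat 1"
  shows "matrix_inv A = B"
  unfolding matrix_inv_def
proof (rule some_equality)
  show "C = B" if "A ** C = mat 1 \<and> C ** A = mat 1" for C
    using assms that by (metis matrix_mul_assoc matrix_mul_lid matrix_mul_rid)
qed (use assms in auto)

lemma matrix_inv_symmetric_corner_1:
  fixes a b :: real
  assumes d: "a - b\<^sup>2 \<noteq> 0"
  shows "matrix_inv (vector [vector [a, b], vector [b, 1]] :: real^2^2) =
     vector [vector [1 / (a - b\<^sup>2), - b / (a - b\<^sup>2)], vector [- b / (a - b\<^sup>2), a / (a - b\<^sup>2)]]"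
proof (rule matrix_inv_eqI)
  have 1: "a / (a - b\<^sup>2) - b * b / (a - b\<^sup>2) = 1"
    using d by (simp add: power2_eq_square flip: diff_divide_distrib)
  show "(vector [vector [a, b], vector [b, 1]] :: real^2^2) ** vector [vector [1 / (a - b\<^sup>2), - b / (a - b\<^sup>2)], vector [- b / (a - b\<^sup>2), a / (a - b\<^sup>2)]] = mat 1"
    using 1 by (simp add: vec_eq_iff forall_2 matrix_matrix_mult_def mat_def sum_2)
  show "vector [vector [1 / (a - b\<^sup>2), - b / (a - b\<^sup>2)], vector [- b / (a - b\<^sup>2), a / (a - b\<^sup>2)]] ** (vector [vector [a, b], vector [b, 1]] :: real^2^2) = mat 1"
    using 1 by (simp add: vec_eq_iff forall_2 matrix_matrix_mult_def mat_def sum_2)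
qed

text \<open>The only coefficient of the metric that varies is the mixed one, and it varies only with \<open>z\<close>.
  The Riccati equation \<open>dC = (1 - C\<^sup>2) dz / (2 lam)\<close> makes its derivative proportional to the
  determinant \<open>4 lam\<^sup>2 (1 - C\<^sup>2)\<close>, so the latter cancels from the symbols. The geodesic equations
  become \<open>y'' = z'\<^sup>2 / (4 lam\<^sup>2)\<close> and \<open>z'' = C z'\<^sup>2 / (2 lam)\<close>.\<close>
lemma christoffel_tilted_form:
  assumes "lam > 0" "open S" "p \<in> S"
    and h: "\<And>q. q \<in> S \<Longrightarrow> h q = tilted_form lam (C q)"
    and C: "(C has_derivative (\<lambda>v. (1 - (C p)\<^sup>2) * (v $ 2 / (2 * lam)))) (at p)"
    and nz: "(C p)\<^sup>2 \<noteq> 1"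
  shows "christoffel h p k i j =
    (if i = 2 \<and> j = 2 then (if k = 1 then - 1 / (4 * lam\<^sup>2) else - C p / (2 * lam)) else 0)"
proof -
  have gram: "gram h q = vector [vector [4 * lam\<^sup>2, - 2 * lam * C q], vector [- 2 * lam * C q, 1]]"
    if "q \<in> S" for q
    by (simp add: vec_eq_iff forall_2 gram_def h[OF that] tilted_form_def axis_def)
  have det: "4 * lam\<^sup>2 - (- 2 * lam * C p)\<^sup>2 = 4 * lam\<^sup>2 * (1 - (C p)\<^sup>2)"
    by (simp add: power_mult_distrib right_diff_distrib)
  have d: "4 * lam\<^sup>2 * (1 - (C p)\<^sup>2) \<noteq> 0" using assms by simp
  have inv: "matrix_inv (gram h p) =
     vector [vector [1 / (4 * lam\<^sup>2 * (1 - (C p)\<^sup>2)), 2 * lam * C p / (4 * lam\<^sup>2 * (1 - (C p)\<^sup>2))],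
       vector [2 * lam * C p / (4 * lam\<^sup>2 * (1 - (C p)\<^sup>2)), 4 * lam\<^sup>2 / (4 * lam\<^sup>2 * (1 - (C p)\<^sup>2))]]"
    using matrix_inv_symmetric_corner_1[of "4 * lam\<^sup>2" "- 2 * lam * C p"] d unfolding det gram[OF \<open>p \<in> S\<close>] by simp
  have pd: "pd_gram h p i j l = (if i = 2 \<and> j \<noteq> l then - (1 - (C p)\<^sup>2) else 0)" for i j l
  proof -
    have "((\<lambda>q. gram h q $ j $ l) has_derivative
      (\<lambda>v. if j \<noteq> l then (- 2 * lam) * ((1 - (C p)\<^sup>2) * (v $ 2 / (2 * lam))) else 0)) (at p)"
    proof (rule has_derivative_transform_within_open[OF _ \<open>open S\<close> \<open>p \<in> S\<close>])
      let ?g = "\<lambda>q. if j \<noteq> l then (- 2 * lam) * C q else if j = 1 then 4 * lam\<^sup>2 else 1"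
      show "?g q = gram h q $ j $ l" if "q \<in> S" for q
        using exhaust_2[of j] exhaust_2[of l] by (auto simp: gram[OF that])
      show "(?g has_derivative
        (\<lambda>v. if j \<noteq> l then (- 2 * lam) * ((1 - (C p)\<^sup>2) * (v $ 2 / (2 * lam))) else 0)) (at p)"
      proof (cases "j = l")
        case False
        then show ?thesis using has_derivative_mult_right[OF C, of "- 2 * lam"] by simp
      qed simp
    qed
    from frechet_derivative_at[OF this, symmetric] show ?thesis
      using \<open>lam > 0\<close> exhaust_2[of i] by (auto simp: pd_gram_def axis_def)
  qed
  define D where "D = 1 - (C p)\<^sup>2"
  have "D \<noteq> 0" using nz by (simp add: D_def)
  then show ?thesis
    using exhaust_2[of i] exhaust_2[of j] exhaust_2[of k] \<open>lam > 0\<close>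
    unfolding christoffel_def sum_2 pd inv D_def[symmetric]
    by (elim disjE) (simp_all add: power2_eq_square[of lam])
qed

section \<open>Maximal domains are half planes\<close>

definition half_plane :: "real \<Rightarrow> real \<Rightarrow> (real^2) set" where
  "half_plane z0 \<epsilon> = {p. 0 < \<epsilon> * (p $ 2 - z0)}"

lemma open_half_plane: "open (half_plane z0 \<epsilon>)"
  unfolding half_plane_def by (intro open_Collect_less continuous_intros)

lemma connected_half_plane: "connected (half_plane z0 \<epsilon>)"
proof -
  have "half_plane z0 \<epsilon> = {p. inner (\<epsilon> *\<^sub>R axis 2 1) p > \<epsilon> * z0}"
    by (auto simp: half_plane_def inner_axis' algebra_simps)
  then show ?thesis
    by (simp only: convex_halfspace_gt convex_connected)
qed

lemma smooth_on_solution: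
  assumes "lam > 0" "open S" and S: "\<And>p. p \<in> S \<Longrightarrow> p $ 2 \<noteq> z0"
  shows "smooth_on S (solution lam a0 z0)"
proof -
  have "C_on (Suc k) S (solution lam a0 z0)" for k
  proof (rule C_on_SucI[OF \<open>open S\<close> has_derivative_solution[OF \<open>lam > 0\<close> S]])
    fix v :: "real^2"
    have "C_on k S (\<lambda>p. - 2 * lam\<^sup>2 * v $ 1 + (2 * lam * v $ 2) * coth_z lam z0 p)"
      using assms by (intro C_on_add C_on_mult C_on_const C_on_coth_z)
    then show "C_on k S (\<lambda>p. - 2 * lam\<^sup>2 * v $ 1 + 2 * lam * coth_z lam z0 p * v $ 2)"
      by (simp add: mult_ac)
  qed
  then show ?thesis
    by (rule smooth_onI)
qed

text \<open>Connectedness confines \<open>\<Omega>\<close> to one side of the line \<open>z = z0\<close>; as the formula is smooth on the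
  whole of that side, maximality forces equality.\<close>
lemma inextensible_domain_half_plane:
  assumes "lam > 0"
    and \<Omega>: "inextensible_domain {p. sinh ((p $ 2 - z0) / (2 * lam)) \<noteq> 0} (solution lam a0 z0) \<Omega>"
  shows "\<exists>\<epsilon>\<in>{1, -1}. \<Omega> = half_plane z0 \<epsilon>"
proof -
  let ?D = "{p::real^2. sinh ((p $ 2 - z0) / (2 * lam)) \<noteq> 0}"
  have D: "p \<in> ?D \<longleftrightarrow> p $ 2 \<noteq> z0" for p
    using \<open>lam > 0\<close> by simp
  have "connected \<Omega>" "\<Omega> \<subseteq> ?D"
    using \<Omega> by (auto simp: inextensible_domain_def formula_domain_def)
  then have "\<Omega> \<subseteq> half_plane z0 1 \<union> half_plane z0 (-1)"
    unfolding half_plane_def subset_iff D by auto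
  moreover have "half_plane z0 1 \<inter> half_plane z0 (-1) \<inter> \<Omega> = {}"
    by (auto simp: half_plane_def)
  ultimately have "half_plane z0 1 \<inter> \<Omega> = {} \<or> half_plane z0 (-1) \<inter> \<Omega> = {}"
    using connectedD[OF \<open>connected \<Omega>\<close> open_half_plane open_half_plane] by blast
  with \<open>\<Omega> \<subseteq> half_plane z0 1 \<union> half_plane z0 (-1)\<close>
  obtain \<epsilon> where \<epsilon>: "\<epsilon> \<in> {1, -1::real}" "\<Omega> \<subseteq> half_plane z0 \<epsilon>" by blast
  have off: "p $ 2 \<noteq> z0" if "p \<in> half_plane z0 \<epsilon>" for p
    using that by (auto simp: half_plane_def)
  have "formula_domain ?D (solution lam a0 z0) (half_plane z0 \<epsilon>)"
    unfolding formula_domain_def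
    using smooth_on_solution[OF \<open>lam > 0\<close> open_half_plane off] off D
    by (auto simp: open_half_plane connected_half_plane)
  with \<Omega> \<epsilon> show ?thesis
    unfolding inextensible_domain_def by blast
qed

section \<open>Geodesics that escape in finite time\<close>

text \<open>The parameter \<open>\<epsilon> = \<plusminus>1\<close> is the side of the line \<open>z = z0\<close>, and \<open>c\<close> is the value of the first integral
  that belongs to the Killing field \<open>\<partial>\<^sub>y\<close>. The curve is meant for \<open>t < 0\<close>, where \<open>- sinh t > 0\<close>.\<close>
definition escaping_curve :: "real \<Rightarrow> real \<Rightarrow> real \<Rightarrow> real \<Rightarrow> real \<Rightarrow> real^2" where
  "escaping_curve lam z0 \<epsilon> c t =
     vector [c * t - ln (- sinh t), z0 + 2 * lam * arsinh (- \<epsilon> / sinh t)]"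

definition escaping_velocity :: "real \<Rightarrow> real \<Rightarrow> real \<Rightarrow> real \<Rightarrow> real^2" where
  "escaping_velocity lam \<epsilon> c t = vector [c - coth t, - 2 * lam * \<epsilon> * (1 / sinh t)]"

lemma has_vector_derivative_vector_2:
  assumes "(f has_real_derivative f') (at t)" "(g has_real_derivative g') (at t)"
  shows "((\<lambda>t. vector [f t, g t] :: real^2) has_vector_derivative vector [f', g']) (at t)"
  unfolding has_vector_derivative_def
proof (rule has_derivative_vecI)
  show "((\<lambda>t. (vector [f t, g t] :: real^2) $ i) has_derivative (\<lambda>h. (h *\<^sub>R vector [f', g']) $ i)) (at t)" for i
    using exhaust_2[of i] assms
    by (auto simp: has_field_derivative_def mult.commute[of _ f'] mult.commute[of _ g'])
qed

lemma sqrt_inverse_sinh_squared: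
  assumes "\<epsilon> \<in> {1, -1}" "t < 0"
  shows "sqrt ((- \<epsilon> / sinh t)\<^sup>2 + 1) = cosh t / (- sinh t)"
proof (rule real_sqrt_unique)
  have "\<epsilon>\<^sup>2 = 1" using assms by auto
  then have "(- \<epsilon> / sinh t)\<^sup>2 + 1 = ((sinh t)\<^sup>2 + 1) / (sinh t)\<^sup>2"
    using assms by (simp add: power_divide add_divide_distrib)
  then show "(cosh t / (- sinh t))\<^sup>2 = (- \<epsilon> / sinh t)\<^sup>2 + 1"
    by (simp add: power_divide cosh_square_eq)
  have "- sinh t > 0" using \<open>t < 0\<close> by simp
  then show "0 \<le> cosh t / (- sinh t)"
    by (intro divide_nonneg_pos cosh_real_nonneg)
qed

text \<open>From \<open>sinh s = - \<epsilon> / sinh t\<close> follows \<open>cosh s = - coth t\<close>. The quotient \<open>\<epsilon> cosh t\<close> turns the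
  geodesic equations and the energy into identities between \<open>sinh t\<close> and \<open>cosh t\<close>.\<close>
lemma coth_z_escaping_curve:
  assumes "lam > 0" "\<epsilon> \<in> {1, -1}" "t < 0"
  shows "coth_z lam z0 (escaping_curve lam z0 \<epsilon> c t) = \<epsilon> * cosh t"
  using assms(2) \<open>lam > 0\<close> \<open>t < 0\<close>
    cosh_arsinh_real[of "- \<epsilon> / sinh t"] sqrt_inverse_sinh_squared[OF assms(2,3)]
  by (auto simp: coth_z_def coth_def escaping_curve_def)

lemma escaping_curve_in_half_plane:
  assumes "lam > 0" "\<epsilon> \<in> {1, -1}" "t < 0"
  shows "escaping_curve lam z0 \<epsilon> c t \<in> half_plane z0 \<epsilon>"
proof -
  have "0 < arsinh (- 1 / sinh t)"
    using \<open>t < 0\<close> by (simp add: divide_neg_neg)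
  then have "lam * arsinh (1 / sinh t) < 0"
    using \<open>lam > 0\<close> by (simp add: mult_pos_neg)
  then show ?thesis
    using assms by (auto simp: half_plane_def escaping_curve_def)
qed

lemma DERIV_escaping_components:
  assumes "\<epsilon> \<in> {1, -1}" "t < 0"
  shows "((\<lambda>t. c * t - ln (- sinh t)) has_real_derivative c - coth t) (at t)"
    and "((\<lambda>t. z0 + 2 * lam * arsinh (- \<epsilon> / sinh t)) has_real_derivative
           - 2 * lam * \<epsilon> * (1 / sinh t)) (at t)"
proof -
  have "- sinh t > 0" using assms by simp
  have "((\<lambda>t. ln (- sinh t)) has_real_derivative inverse (- sinh t) * - (cosh t * 1)) (at t)"
    by (rule DERIV_chain2[OF DERIV_ln[OF \<open>- sinh t > 0\<close>]
          DERIV_minus[OF has_field_derivative_sinh[OF DERIV_ident]]])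
  then have "((\<lambda>t. ln (- sinh t)) has_real_derivative coth t) (at t)"
    by (simp add: coth_def field_simps)
  from DERIV_diff[OF DERIV_cmult_Id this]
  show "((\<lambda>t. c * t - ln (- sinh t)) has_real_derivative c - coth t) (at t)" .
  have "((\<lambda>t. - \<epsilon> * (1 / sinh t)) has_real_derivative - \<epsilon> * (- 1 * (coth t * (1 / sinh t)))) (at t)"
    using assms by (intro DERIV_cmult DERIV_inverse_sinh) simp
  then have "((\<lambda>t. - \<epsilon> / sinh t) has_real_derivative \<epsilon> * coth t / sinh t) (at t)"
    by simp
  from DERIV_chain2[OF arsinh_real_has_field_derivative this]
  have "((\<lambda>t. arsinh (- \<epsilon> / sinh t)) has_real_derivative
      1 / (cosh t / (- sinh t)) * (\<epsilon> * coth t / sinh t)) (at t)"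
    unfolding sqrt_inverse_sinh_squared[OF assms] .
  moreover have "1 / (cosh t / (- sinh t)) * (\<epsilon> * coth t / sinh t) = - \<epsilon> * (1 / sinh t)"
    using assms(2) by (simp add: coth_def)
  ultimately have "((\<lambda>t. arsinh (- \<epsilon> / sinh t)) has_real_derivative - \<epsilon> * (1 / sinh t)) (at t)"
    by simp
  from DERIV_add[OF DERIV_const DERIV_cmult[OF this, of "2 * lam"]]
  show "((\<lambda>t. z0 + 2 * lam * arsinh (- \<epsilon> / sinh t)) has_real_derivative
           - 2 * lam * \<epsilon> * (1 / sinh t)) (at t)"
    by (simp add: mult.assoc)
qed

lemma velocity_escaping_curve:
  assumes "\<epsilon> \<in> {1, -1}" "t < 0"
  shows "velocity (escaping_curve lam z0 \<epsilon> c) t = escaping_velocity lam \<epsilon> c t"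
  unfolding escaping_velocity_def escaping_curve_def
  by (rule vector_derivative_at has_vector_derivative_vector_2 DERIV_escaping_components assms)+

lemma acceleration_escaping_curve:
  assumes "\<epsilon> \<in> {1, -1}" "t < 0"
  shows "velocity (velocity (escaping_curve lam z0 \<epsilon> c)) t =
    vector [(coth t)\<^sup>2 - 1, 2 * lam * \<epsilon> * (coth t * (1 / sinh t))]"
proof (rule vector_derivative_at, rule has_vector_derivative_transform_within_open)
  have "((\<lambda>t. c - coth t) has_real_derivative 0 - (1 - (coth t)\<^sup>2)) (at t)"
    using \<open>t < 0\<close> by (intro DERIV_diff DERIV_const DERIV_coth) simp
  moreover have "((\<lambda>t. - 2 * lam * \<epsilon> * (1 / sinh t)) has_real_derivative
      - 2 * lam * \<epsilon> * (- 1 * (coth t * (1 / sinh t)))) (at t)"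
    using \<open>t < 0\<close> by (intro DERIV_cmult DERIV_inverse_sinh) simp
  ultimately show "((\<lambda>t. escaping_velocity lam \<epsilon> c t) has_vector_derivative
      vector [(coth t)\<^sup>2 - 1, 2 * lam * \<epsilon> * (coth t * (1 / sinh t))]) (at t)"
    unfolding escaping_velocity_def by (intro has_vector_derivative_vector_2) simp_all
  show "open {..<0::real}" "t \<in> {..<0}"
    using \<open>t < 0\<close> by auto
  show "escaping_velocity lam \<epsilon> c s = velocity (escaping_curve lam z0 \<epsilon> c) s" if "s \<in> {..<0}" for s
    using that velocity_escaping_curve[OF assms(1)] by simp
qed

lemma smooth_on_escaping_curve:
  assumes "\<epsilon> \<in> {1, -1}"
  shows "smooth_on {..<0} (escaping_curve lam z0 \<epsilon> c)"
proof -
  have "C_on (Suc k) {..<0} (\<lambda>t. escaping_curve lam z0 \<epsilon> c t $ i)" for k i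
  proof -
    have "C_on k {..<0} (\<lambda>t. c + (- 1) * coth t)"
      by (intro C_on_add C_on_mult C_on_const C_on_coth) auto
    then have "C_on (Suc k) {..<0} (\<lambda>t. c * t - ln (- sinh t))"
      using DERIV_escaping_components(1)[OF assms]
      by (intro C_on_SucI_real[where f' = "\<lambda>t. c - coth t"]) auto
    moreover have "C_on k {..<0::real} (\<lambda>t. - 2 * lam * \<epsilon> * (1 / sinh t))"
      by (intro C_on_mult C_on_const C_on_inverse_sinh) auto
    then have "C_on (Suc k) {..<0} (\<lambda>t. z0 + 2 * lam * arsinh (- \<epsilon> / sinh t))"
      using DERIV_escaping_components(2)[OF assms]
      by (intro C_on_SucI_real[where f' = "\<lambda>t. - 2 * lam * \<epsilon> * (1 / sinh t)"]) auto
    ultimately show ?thesis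
      using exhaust_2[of i] by (auto simp only: escaping_curve_def vector_2)
  qed
  then show ?thesis
    by (intro smooth_onI C_on_vecI) auto
qed

lemma geodesic_escaping_curve:
  assumes "lam > 0" "\<epsilon> \<in> {1, -1}"
  shows "geodesic (pullback (graph_map (solution lam a0 z0)) L3_metric) (half_plane z0 \<epsilon>) {..<0}
    (escaping_curve lam z0 \<epsilon> c)"
proof -
  let ?h = "pullback (graph_map (solution lam a0 z0)) L3_metric"
  let ?\<gamma> = "escaping_curve lam z0 \<epsilon> c"
  have off: "p $ 2 \<noteq> z0" if "p \<in> half_plane z0 \<epsilon>" for p
    using that by (auto simp: half_plane_def)
  have "velocity (velocity ?\<gamma>) t $ k +
      (\<Sum>i\<in>UNIV. \<Sum>j\<in>UNIV. christoffel ?h (?\<gamma> t) k i j * velocity ?\<gamma> t $ i * velocity ?\<gamma> t $ j) = 0"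
    if t: "t < 0" for t k
  proof -
    note p = escaping_curve_in_half_plane[OF assms t, of z0 c]
    note C = coth_z_escaping_curve[OF assms t, of z0 c]
    have \<Gamma>: "christoffel ?h (?\<gamma> t) k i j =
      (if i = 2 \<and> j = 2 then (if k = 1 then - 1 / (4 * lam\<^sup>2) else - (\<epsilon> * cosh t) / (2 * lam)) else 0)" for i j
      using christoffel_tilted_form[where h = ?h and C = "coth_z lam z0", OF \<open>lam > 0\<close> open_half_plane p
          induced_metric[OF \<open>lam > 0\<close> off] has_derivative_coth_z[OF \<open>lam > 0\<close> off[OF p]]]
        coth_z_squared_gt_1[OF \<open>lam > 0\<close> off[OF p]]
      by (simp add: C)
    have "\<epsilon> * \<epsilon> = 1" using assms(2) by auto
    have sq: "(coth t)\<^sup>2 - 1 = 1 / (sinh t)\<^sup>2"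
      using one_minus_coth_squared[of t] t by simp
    show ?thesis
      using exhaust_2[of k] \<open>lam > 0\<close> t \<open>\<epsilon> * \<epsilon> = 1\<close>
      unfolding sum_2 \<Gamma> velocity_escaping_curve[OF assms(2) t] acceleration_escaping_curve[OF assms(2) t]
        escaping_velocity_def
      by (elim disjE; simp add: sq; simp add: coth_def power2_eq_square field_simps)
  qed
  then show ?thesis
    using assms by (auto simp: geodesic_def smooth_on_escaping_curve escaping_curve_in_half_plane)
qed

text \<open>A larger interval contains \<open>0\<close>. Along the curve the product \<open>sinh s * sinh t\<close> has the constant
  value \<open>- \<epsilon> \<noteq> 0\<close>, but a continuous extension to \<open>t = 0\<close> would make it tend to \<open>0\<close>.\<close>
lemma inextensible_escaping_curve:
  assumes "lam > 0" "\<epsilon> \<in> {1, -1}"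
  shows "inextensible_geodesic (pullback (graph_map (solution lam a0 z0)) L3_metric)
    (half_plane z0 \<epsilon>) {..<0} (escaping_curve lam z0 \<epsilon> c)"
  unfolding inextensible_geodesic_def
proof (intro conjI geodesic_escaping_curve[OF assms] allI impI, elim conjE)
  let ?\<gamma> = "escaping_curve lam z0 \<epsilon> c"
  fix J and \<sigma> :: "real \<Rightarrow> real^2"
  assume geo: "geodesic (pullback (graph_map (solution lam a0 z0)) L3_metric) (half_plane z0 \<epsilon>) J \<sigma>"
    and J: "{..<0} \<subseteq> J" and \<sigma>: "\<forall>t\<in>{..<0}. \<sigma> t = ?\<gamma> t"
  have "0 \<notin> J"
  proof
    assume "0 \<in> J"
    have "open J" "C_on 0 J \<sigma>"
      using geo by (auto simp: geodesic_def smooth_on_def simp del: C_on.simps)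
    then have "isCont \<sigma> 0"
      using \<open>0 \<in> J\<close> by (simp add: continuous_on_eq_continuous_at)
    then have "isCont (\<lambda>t. sinh ((\<sigma> t $ 2 - z0) / (2 * lam)) * sinh t) 0"
      using \<open>lam > 0\<close> by (intro continuous_intros) auto
    then have "((\<lambda>t. sinh ((\<sigma> t $ 2 - z0) / (2 * lam)) * sinh t) \<longlongrightarrow> 0) (at 0)"
      by (simp add: isCont_def)
    then have lim0: "((\<lambda>t. sinh ((\<sigma> t $ 2 - z0) / (2 * lam)) * sinh t) \<longlongrightarrow> 0) (at_left 0)"
      by (rule tendsto_within_subset) simp
    have "sinh ((\<sigma> t $ 2 - z0) / (2 * lam)) * sinh t = - \<epsilon>" if "t < 0" for t
      using \<sigma> that \<open>lam > 0\<close> by (simp add: escaping_curve_def)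
    then have "\<forall>\<^sub>F t in at_left 0. sinh ((\<sigma> t $ 2 - z0) / (2 * lam)) * sinh t = - \<epsilon>"
      by (auto simp: eventually_at_filter)
    then have "((\<lambda>t. sinh ((\<sigma> t $ 2 - z0) / (2 * lam)) * sinh t) \<longlongrightarrow> - \<epsilon>) (at_left 0)"
      by (rule tendsto_eventually)
    with lim0 have "- \<epsilon> = 0"
      using tendsto_unique trivial_limit_at_left_real by blast
    with assms(2) show False by auto
  qed
  moreover have "connected J"
    using geo by (simp add: geodesic_def)
  ultimately have "t < 0" if "t \<in> J" for t
    using connectedD_interval[of J "-1" t 0] J that by force
  with J show "J = {..<0}" by auto
qed

text \<open>The factor \<open>c\<^sup>2 - 1\<close> is what allows every causal type to be realised by choice of \<open>c\<close>.\<close>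
lemma energy_escaping_curve:
  assumes "lam > 0" "\<epsilon> \<in> {1, -1}" "t < 0"
  shows "pullback (graph_map (solution lam a0 z0)) L3_metric (escaping_curve lam z0 \<epsilon> c t)
      (escaping_velocity lam \<epsilon> c t) (escaping_velocity lam \<epsilon> c t) = 4 * lam\<^sup>2 * (c\<^sup>2 - 1)"
proof -
  have p: "escaping_curve lam z0 \<epsilon> c t $ 2 \<noteq> z0"
    using escaping_curve_in_half_plane[OF assms, of z0 c] by (auto simp: half_plane_def)
  have "\<epsilon> * \<epsilon> = 1" using assms(2) by auto
  \<comment> \<open>With \<open>1 / sinh t\<close> opaque, the expansion below is an identity of polynomials.\<close>
  define r where "r = 1 / sinh t"
  have "cosh t * (1 / sinh t) = coth t" by (simp add: coth_def)
  have q: "(1 / sinh t)\<^sup>2 = (coth t)\<^sup>2 - 1"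
    using one_minus_coth_squared[of t] \<open>t < 0\<close> by (simp add: power_divide)
  have "tilted_form lam (\<epsilon> * cosh t) (escaping_velocity lam \<epsilon> c t) (escaping_velocity lam \<epsilon> c t) =
     4 * lam\<^sup>2 * ((c - coth t)\<^sup>2 + 2 * (\<epsilon> * \<epsilon>) * (c - coth t) * (cosh t * (1 / sinh t))
       + (\<epsilon> * \<epsilon>) * (1 / sinh t)\<^sup>2)"
    unfolding tilted_form_def escaping_velocity_def vector_2
    unfolding r_def[symmetric] by (simp add: power2_eq_square algebra_simps)
  also have "\<dots> = 4 * lam\<^sup>2 * (c\<^sup>2 - 1)"
    unfolding \<open>\<epsilon> * \<epsilon> = 1\<close> \<open>cosh t * (1 / sinh t) = coth t\<close> q
    by (simp add: power2_eq_square algebra_simps)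
  finally show ?thesis
    unfolding induced_metric[OF \<open>lam > 0\<close> p] coth_z_escaping_curve[OF assms] .
qed

text \<open>All three kinds of incompleteness have the same proof up to the sign of the energy. The causal
  condition is therefore left as a hypothesis on vectors with the energy in question; the velocity is
  kept explicit in it because being light-like also requires the vector to be nonzero.\<close>
lemma incomplete_on_half_planeI:
  assumes "lam > 0" "\<epsilon> \<in> {1, -1}"
    and causal: "\<And>p t. pullback (graph_map (solution lam a0 z0)) L3_metric p
        (escaping_velocity lam \<epsilon> c t) (escaping_velocity lam \<epsilon> c t) = 4 * lam\<^sup>2 * (c\<^sup>2 - 1) \<Longrightarrow> t < 0 \<Longrightarrow>
      causal (pullback (graph_map (solution lam a0 z0)) L3_metric p) (escaping_velocity lam \<epsilon> c t)"
  shows "incomplete_on causal (half_plane z0 \<epsilon>) (pullback (graph_map (solution lam a0 z0)) L3_metric)"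
  unfolding incomplete_on_def
proof (intro exI conjI ballI)
  show "inextensible_geodesic (pullback (graph_map (solution lam a0 z0)) L3_metric)
    (half_plane z0 \<epsilon>) {..<0} (escaping_curve lam z0 \<epsilon> c)"
    by (rule inextensible_escaping_curve[OF assms(1,2)])
  show "causal (pullback (graph_map (solution lam a0 z0)) L3_metric (escaping_curve lam z0 \<epsilon> c t))
     (velocity (escaping_curve lam z0 \<epsilon> c) t)" if "t \<in> {..<0}" for t
    using that causal[OF energy_escaping_curve[OF assms(1,2)]]
    by (simp add: velocity_escaping_curve[OF assms(2)])
  show "{..<0::real} \<noteq> UNIV"
    by (metis UNIV_I lessThan_iff less_irrefl)
qed

theorem corollary3p4:
  fixes lam a0 z0 :: real and u :: "real^2 \<Rightarrow> real" and \<Omega> :: "(real^2) set"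
  assumes "lam > 0"
    and "u = (\<lambda>p. - 2 * lam^2 * p $ 1
               + 4 * lam^2 * ln \<bar>sinh ((p $ 2 - z0) / (2 * lam))\<bar> + a0)"
    and "inextensible_domain {p. sinh ((p $ 2 - z0) / (2 * lam)) \<noteq> 0} u \<Omega>"
  shows "lorentzian_on \<Omega> (pullback (graph_map u) L3_metric)
    \<and> \<Omega> \<noteq> UNIV
    \<and> incomplete_on spacelike \<Omega> (pullback (graph_map u) L3_metric)
    \<and> incomplete_on timelike \<Omega> (pullback (graph_map u) L3_metric)
    \<and> incomplete_on lightlike \<Omega> (pullback (graph_map u) L3_metric)"
proof -
  have u: "u = solution lam a0 z0"
    by (simp add: assms(2) solution_def fun_eq_iff)
  obtain \<epsilon> where \<epsilon>: "\<epsilon> \<in> {1, -1}" and \<Omega>: "\<Omega> = half_plane z0 \<epsilon>"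
    using inextensible_domain_half_plane assms(1,3) unfolding u by blast
  have off: "p $ 2 \<noteq> z0" if "p \<in> half_plane z0 \<epsilon>" for p
    using that by (auto simp: half_plane_def)
  show ?thesis
    unfolding u \<Omega>
  proof (intro conjI)
    show "lorentzian_on (half_plane z0 \<epsilon>) (pullback (graph_map (solution lam a0 z0)) L3_metric)"
      by (rule lorentzian_on_solution[OF \<open>lam > 0\<close> open_half_plane off])
    show "half_plane z0 \<epsilon> \<noteq> UNIV"
      using off[of "vector [0, z0]"] by auto
    show "incomplete_on spacelike (half_plane z0 \<epsilon>) (pullback (graph_map (solution lam a0 z0)) L3_metric)"
      by (rule incomplete_on_half_planeI[OF \<open>lam > 0\<close> \<epsilon>, where c = 2]) (use \<open>lam > 0\<close> in \<open>simp add: spacelike_def\<close>)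
    show "incomplete_on timelike (half_plane z0 \<epsilon>) (pullback (graph_map (solution lam a0 z0)) L3_metric)"
      by (rule incomplete_on_half_planeI[OF \<open>lam > 0\<close> \<epsilon>, where c = 0]) (use \<open>lam > 0\<close> in \<open>simp add: timelike_def\<close>)
    show "incomplete_on lightlike (half_plane z0 \<epsilon>) (pullback (graph_map (solution lam a0 z0)) L3_metric)"
    proof (rule incomplete_on_half_planeI[OF \<open>lam > 0\<close> \<epsilon>, where c = 1])
      fix p t
      assume e: "pullback (graph_map (solution lam a0 z0)) L3_metric p (escaping_velocity lam \<epsilon> 1 t)
          (escaping_velocity lam \<epsilon> 1 t) = 4 * lam\<^sup>2 * (1\<^sup>2 - 1)" and "t < (0::real)"
      have "escaping_velocity lam \<epsilon> 1 t $ 2 \<noteq> 0"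
        using \<open>lam > 0\<close> \<epsilon> \<open>t < 0\<close> by (auto simp: escaping_velocity_def)
      with e show "lightlike (pullback (graph_map (solution lam a0 z0)) L3_metric p)
          (escaping_velocity lam \<epsilon> 1 t)"
        by (auto simp: lightlike_def)
    qed
  qed
qed

end
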